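(* Let $(X,L,\tau,l)$ be a labelled Markov chain, $\varepsilon\in[0,1]\cap\mathbb{Q}$, and $x,y\in X$. If there is a proof tree built from the rules (zero), (symm), (weak), (lab), (exp) with $x\mathrel{\#_{\varepsilon}}y$ at its root, then there is a formula $\varphi_{xy}\in\mathcal{L}$ such that $[\![\varphi_{xy}]\!](x)=\varepsilon$ and $[\![\varphi_{xy}]\!](y)=0$.
   Context: A labelled Markov chain (LMC) $(X,L,\tau,l)$ consists of a set of states $X$, a non-empty set of labels $L$, a transition function $\tau\colon X\to\mathcal{D}_{\mathbb{Q}}(X)$ where $\mathcal{D}_{\mathbb{Q}}(X)$ is the set of finitely supported distributions $\mu\colon X\to[0,1]\cap\mathbb{Q}$ with $\sum_x\mu(x)=1$, and a labelling $l\colon X\to L$. For a distribution $\mu$ and a function $h$ defined on a set containing $\operatorname{supp}(\mu)$, $\mu\models h:=\sum_{z\in\operatorname{supp}(\mu)}\mu(z)h(z)$. The logic $\mathcal{L}$ has syntax $\varphi::=a\mid\bigcirc\varphi\mid\neg\varphi\mid\varphi\ominus q\mid\varphi\vee\varphi$ with $a\in L$, $q\in[0,1]\cap\mathbb{Q}$ (formulas are finite), and semantics $[\![\cdot]\!]\colon\mathcal{L}\to(X\to[0,1]\cap\mathbb{Q})$: $[\![a]\!](x)=1$ if $l(x)=a$ and $0$ otherwise; $[\![\bigcirc\varphi]\!](x)=\tau(x)\models[\![\varphi]\!]$; $[\![\neg\varphi]\!](x)=1-[\![\varphi]\!](x)$; $[\![\varphi\ominus q]\!](x)=\max(0,[\![\varphi]\!](x)-q)$;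 $[\![\varphi\vee\psi]\!](x)=\max([\![\varphi]\!](x),[\![\psi]\!](x))$. Derivation rules, with judgments $x\mathrel{\#_{\varepsilon}}y$ for $x,y\in X$, $\varepsilon\in[0,1]\cap\mathbb{Q}$, and $\mathcal{S}=\mathcal{S}_{x,y}:=\operatorname{supp}(\tau(x))\cup\operatorname{supp}(\tau(y))$: (zero): $x\mathrel{\#_0}y$ with no premises. (symm): from $y\mathrel{\#_{\varepsilon}}x$ infer $x\mathrel{\#_{\varepsilon}}y$. (weak): from $x\mathrel{\#_{\varepsilon'}}y$ and $\varepsilon\le\varepsilon'$ infer $x\mathrel{\#_{\varepsilon}}y$. (lab): if $l(x)\neq l(y)$ infer $x\mathrel{\#_1}y$. (exp): given a map $h\colon\mathcal{S}\to[0,1]\cap\mathbb{Q}$, proofs of $x'\mathrel{\#_{h(x')-h(y')}}y'$ for all $x',y'\in\mathcal{S}$ with $h(x')>h(y')$, and $\tau(x)\models h-\tau(y)\models h\ge\varepsilon$, infer $x\mathrel{\#_{\varepsilon}}y$. Proof trees are finite trees built from these rules. *)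

theory Defs
  imports Complex_Main
begin

text \<open>A labelled Markov chain is given by its transition function \<open>\<tau> :: 'x \<Rightarrow> 'x \<Rightarrow> rat\<close>, with
  \<open>\<tau> x \<in> rat_distributions\<close> for all \<open>x\<close>, and its labelling \<open>l :: 'x \<Rightarrow> 'l\<close>. The states and the
  labels are the elements of the types \<open>'x\<close> and \<open>'l\<close>.
  The set of rationals between 0 and 1 is \<open>{0..1} :: rat set\<close>.\<close>

definition supp :: "('x \<Rightarrow> rat) \<Rightarrow> 'x set" where
  "supp \<mu> = {x. \<mu> x \<noteq> 0}"

definition rat_distributions :: "('x \<Rightarrow> rat) set" where
  "rat_distributions =
     {\<mu>. (\<forall>x. \<mu> x \<in> {0..1}) \<and> finite (supp \<mu>) \<and> (\<Sum>x\<in>supp \<mu>. \<mu> x) = 1}"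

definition expect :: "('x \<Rightarrow> rat) \<Rightarrow> ('x \<Rightarrow> rat) \<Rightarrow> rat" (infix "\<Turnstile>" 70) where
  "\<mu> \<Turnstile> h = (\<Sum>z\<in>supp \<mu>. \<mu> z * h z)"

text \<open>The logic consists of those terms of the following type whose subtracted constants lie
  between 0 and 1.\<close>

datatype 'l formula =
    Label 'l
  | Next "'l formula"
  | Neg "'l formula"
  | Minus "'l formula" rat
  | Disj "'l formula" "'l formula"

inductive_set logic :: "'l formula set" where
  "Label a \<in> logic"
| "\<phi> \<in> logic \<Longrightarrow> Next \<phi> \<in> logic"
| "\<phi> \<in> logic \<Longrightarrow> Neg \<phi> \<in> logic"
| "\<phi> \<in> logic \<Longrightarrow> q \<in> {0..1} \<Longrightarrow> Minus \<phi> q \<in> logic"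
| "\<phi> \<in> logic \<Longrightarrow> \<psi> \<in> logic \<Longrightarrow> Disj \<phi> \<psi> \<in> logic"

primrec sem :: "('x \<Rightarrow> 'x \<Rightarrow> rat) \<Rightarrow> ('x \<Rightarrow> 'l) \<Rightarrow> 'l formula \<Rightarrow> 'x \<Rightarrow> rat" where
  "sem \<tau> l (Label a) = (\<lambda>x. if l x = a then 1 else 0)"
| "sem \<tau> l (Next \<phi>) = (\<lambda>x. \<tau> x \<Turnstile> sem \<tau> l \<phi>)"
| "sem \<tau> l (Neg \<phi>) = (\<lambda>x. 1 - sem \<tau> l \<phi> x)"
| "sem \<tau> l (Minus \<phi> q) = (\<lambda>x. max 0 (sem \<tau> l \<phi> x - q))"
| "sem \<tau> l (Disj \<phi> \<psi>) = (\<lambda>x. max (sem \<tau> l \<phi> x) (sem \<tau> l \<psi> x))"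

text \<open>Derivability of \<open>x #\<^sub>\<epsilon> y\<close>, written \<open>apart \<tau> l x \<epsilon> y\<close>. Judgments are only formed for
  \<open>\<epsilon> \<in> {0..1}\<close>; this is an explicit side condition where the other premises do not force it.
  In \<open>exp\<close>, only the values of the total function \<open>h\<close> on the finite set
  \<open>supp (\<tau> x) \<union> supp (\<tau> y)\<close> matter. The rule has finitely many premises when
  \<open>\<tau>\<close> takes values in \<open>rat_distributions\<close>, so that the derivation trees are finite.\<close>

inductive apart :: "('x \<Rightarrow> 'x \<Rightarrow> rat) \<Rightarrow> ('x \<Rightarrow> 'l) \<Rightarrow> 'x \<Rightarrow> rat \<Rightarrow> 'x \<Rightarrow> bool"
  for \<tau> :: "'x \<Rightarrow> 'x \<Rightarrow> rat" and l :: "'x \<Rightarrow> 'l" where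
  zero: "apart \<tau> l x 0 y"
| symm: "apart \<tau> l y \<epsilon> x \<Longrightarrow> apart \<tau> l x \<epsilon> y"
| weak: "apart \<tau> l x \<epsilon>' y \<Longrightarrow> \<epsilon> \<in> {0..1} \<Longrightarrow> \<epsilon> \<le> \<epsilon>' \<Longrightarrow> apart \<tau> l x \<epsilon> y"
| lab: "l x \<noteq> l y \<Longrightarrow> apart \<tau> l x 1 y"
| exp: "(\<forall>z \<in> supp (\<tau> x) \<union> supp (\<tau> y). h z \<in> {0..1}) \<Longrightarrow>
    (\<forall>x' \<in> supp (\<tau> x) \<union> supp (\<tau> y). \<forall>y' \<in> supp (\<tau> x) \<union> supp (\<tau> y).
       h x' > h y' \<longrightarrow> apart \<tau> l x' (h x' - h y') y') \<Longrightarrow>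
    \<epsilon> \<in> {0..1} \<Longrightarrow> (\<tau> x \<Turnstile> h) - (\<tau> y \<Turnstile> h) \<ge> \<epsilon> \<Longrightarrow> apart \<tau> l x \<epsilon> y"

lemma expect_unit_interval:
  assumes "\<mu> \<in> rat_distributions" and "\<And>z. h z \<in> {0..1}"
  shows "\<mu> \<Turnstile> h \<in> {0..1}"
proof -
  have "\<mu> \<Turnstile> h \<le> (\<Sum>x\<in>supp \<mu>. \<mu> x)"
    using assms unfolding expect_def rat_distributions_def
    by (intro sum_mono) (auto intro: mult_left_le)
  moreover have "0 \<le> \<mu> \<Turnstile> h"
    using assms unfolding expect_def rat_distributions_def
    by (intro sum_nonneg) auto
  ultimately show ?thesis
    using assms(1) by (simp add: rat_distributions_def)
qed

lemma sem_unit_interval: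
  assumes "\<And>x. \<tau> x \<in> rat_distributions" and "\<phi> \<in> logic"
  shows "sem \<tau> l \<phi> x \<in> {0..1}"
  using assms(2)
proof (induction arbitrary: x)
  case (2 \<phi>)
  then show ?case using expect_unit_interval[OF assms(1)] by simp
next
  case (4 \<phi> q)
  have "sem \<tau> l \<phi> x \<in> {0..1}" by (rule 4)
  then show ?case using 4(2) by auto
next
  case (5 \<phi> \<psi>)
  have "sem \<tau> l \<phi> x \<in> {0..1}" "sem \<tau> l \<psi> x \<in> {0..1}" by (rule 5)+
  then show ?case by auto
qed auto

end

theory Submission
  imports Defs
begin

text \<open>Induction on the proof tree. In the case (exp), the induction hypothesis gives, for any two
  points of \<open>supp (\<tau> x) \<union> supp (\<tau> y)\<close>, a formula that takes the values of \<open>h\<close> at these two points.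
  As the logic is closed under \<open>max\<close> and \<open>min\<close>, the lattice argument from the proof of the
  Stone-Weierstrass theorem yields a single formula \<open>\<psi>\<close> that agrees with \<open>h\<close> on the finite set
  \<open>supp (\<tau> x) \<union> supp (\<tau> y)\<close>; a truncated subtraction from \<open>Next \<psi>\<close> then separates \<open>x\<close> from \<open>y\<close>.\<close>

text \<open>The invariant of the induction. The range condition belongs to it so that the constants
  \<open>1 - \<epsilon>\<close> and \<open>\<epsilon>' - \<epsilon>\<close> subtracted for (symm)
  and (weak) are admissible in \<open>logic\<close>.\<close>

definition separable :: "('x \<Rightarrow> 'x \<Rightarrow> rat) \<Rightarrow> ('x \<Rightarrow> 'l) \<Rightarrow> 'x \<Rightarrow> rat \<Rightarrow> 'x \<Rightarrow> bool" where
  "separable \<tau> l x \<epsilon> y \<longleftrightarrow>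
     \<epsilon> \<in> {0..1} \<and> (\<exists>\<phi>\<in>logic. sem \<tau> l \<phi> x = \<epsilon> \<and> sem \<tau> l \<phi> y = 0)"

lemma separable_zero: "separable \<tau> l x 0 y"
  unfolding separable_def
  \<comment> \<open>Subtracting 1 turns any label into the constant 0, so an arbitrary label will
    do.\<close>
  by (auto intro!: bexI[of _ "Minus (Label undefined) 1"] logic.intros)

text \<open>Negation reverses the order of the two values: \<open>Neg \<phi>\<close> is 1 at
  \<open>x\<close> and \<open>1 - \<epsilon>\<close> at \<open>y\<close>, and subtracting
  \<open>1 - \<epsilon>\<close> moves them to \<epsilon> and 0.\<close>

lemma separable_sym:
  assumes "separable \<tau> l y \<epsilon> x"
  shows "separable \<tau> l x \<epsilon> y"
proof -
  obtain \<phi> where "\<phi> \<in> logic" "sem \<tau> l \<phi> y = \<epsilon>" "sem \<tau> l \<phi> x = 0" and "\<epsilon> \<in> {0..1}"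
    using assms unfolding separable_def by blast
  then show ?thesis
    unfolding separable_def
    by (auto intro!: bexI[of _ "Minus (Neg \<phi>) (1 - \<epsilon>)"] logic.intros)
qed

lemma separable_weaken:
  assumes "separable \<tau> l x \<epsilon>' y" and "\<epsilon> \<in> {0..1}" and "\<epsilon> \<le> \<epsilon>'"
  shows "separable \<tau> l x \<epsilon> y"
proof -
  obtain \<phi> where "\<phi> \<in> logic" "sem \<tau> l \<phi> x = \<epsilon>'" "sem \<tau> l \<phi> y = 0" and "\<epsilon>' \<in> {0..1}"
    using assms(1) unfolding separable_def by blast
  then show ?thesis
    using assms(2,3) unfolding separable_def
    by (auto intro!: bexI[of _ "Minus \<phi> (\<epsilon>' - \<epsilon>)"] logic.intros)
qed

lemma separable_label:
  assumes "l x \<noteq> l y"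
  shows "separable \<tau> l x 1 y"
  using assms unfolding separable_def
  by (auto intro!: bexI[of _ "Label (l x)"] logic.intros)

text \<open>\<open>Neg (Minus (Neg \<phi>) q)\<close> is the truncated addition \<open>min 1 (\<phi> + q)\<close>.\<close>

lemma separable_shift:
  assumes "separable \<tau> l x (a - b) y" and "a \<in> {0..1}" and "b \<in> {0..1}"
  shows "\<exists>\<phi>\<in>logic. sem \<tau> l \<phi> x = a \<and> sem \<tau> l \<phi> y = b"
proof -
  obtain \<phi> where "\<phi> \<in> logic" "sem \<tau> l \<phi> x = a - b" "sem \<tau> l \<phi> y = 0"
    using assms(1) unfolding separable_def by blast
  then show ?thesis
    using assms(2,3)
    by (auto intro!: bexI[of _ "Neg (Minus (Neg \<phi>) b)"] logic.intros)
qed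

lemma logic_Max:
  assumes "finite A" and "A \<noteq> {}" and "\<And>a. a \<in> A \<Longrightarrow> f a \<in> logic"
  shows "\<exists>\<psi>\<in>logic. \<forall>z. sem \<tau> l \<psi> z = Max ((\<lambda>a. sem \<tau> l (f a) z) ` A)"
  using assms
proof (induction rule: finite_ne_induct)
  case (singleton a)
  then show ?case by (auto intro!: bexI[of _ "f a"])
next
  case (insert a A)
  then obtain \<psi> where "\<psi> \<in> logic" "\<forall>z. sem \<tau> l \<psi> z = Max ((\<lambda>a. sem \<tau> l (f a) z) ` A)"
    by blast
  with insert show ?case
    by (auto intro!: bexI[of _ "Disj (f a) \<psi>"] logic.intros)
qed

lemma logic_Min:
  assumes "finite A" and "A \<noteq> {}" and "\<And>a. a \<in> A \<Longrightarrow> f a \<in> logic"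
  shows "\<exists>\<psi>\<in>logic. \<forall>z. sem \<tau> l \<psi> z = Min ((\<lambda>a. sem \<tau> l (f a) z) ` A)"
  using assms
proof (induction rule: finite_ne_induct)
  case (singleton a)
  then show ?case by (auto intro!: bexI[of _ "f a"])
next
  case (insert a A)
  then obtain \<psi> where "\<psi> \<in> logic" "\<forall>z. sem \<tau> l \<psi> z = Min ((\<lambda>a. sem \<tau> l (f a) z) ` A)"
    by blast
  moreover have "sem \<tau> l (Neg (Disj (Neg (f a)) (Neg \<psi>))) z = min (sem \<tau> l (f a) z) (sem \<tau> l \<psi> z)"
    for z
    by (simp add: min_def max_def)
  ultimately show ?case
    using insert.hyps insert.prems
    by (intro bexI[of _ "Neg (Disj (Neg (f a)) (Neg \<psi>))"]) (auto simp del: sem.simps intro!: logic.intros)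
qed

lemma logic_interpolation:
  assumes "finite S"
    and "\<And>x y. x \<in> S \<Longrightarrow> y \<in> S \<Longrightarrow> \<exists>\<phi>\<in>logic. sem \<tau> l \<phi> x = h x \<and> sem \<tau> l \<phi> y = h y"
  shows "\<exists>\<psi>\<in>logic. \<forall>z\<in>S. sem \<tau> l \<psi> z = h z"
proof (cases "S = {}")
  case True
  \<comment> \<open>The condition is vacuous here, and any label witnesses that \<open>logic\<close>
    is inhabited.\<close>
  then show ?thesis by (auto intro: logic.intros)
next
  case False
  obtain f where f: "f x y \<in> logic" "sem \<tau> l (f x y) x = h x" "sem \<tau> l (f x y) y = h y"
    if "x \<in> S" "y \<in> S" for x y
    using assms(2) by metis
  have "\<exists>\<psi>\<in>logic. \<forall>z. sem \<tau> l \<psi> z = Min ((\<lambda>y. sem \<tau> l (f x y) z) ` S)" if "x \<in> S" for x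
    using assms(1) False f(1) that by (intro logic_Min)
  then obtain g where g: "g x \<in> logic" "sem \<tau> l (g x) z = Min ((\<lambda>y. sem \<tau> l (f x y) z) ` S)"
    if "x \<in> S" for x z
    by metis
  obtain \<psi> where \<psi>: "\<psi> \<in> logic" "sem \<tau> l \<psi> z = Max ((\<lambda>x. sem \<tau> l (g x) z) ` S)" for z
    using logic_Max[of S g \<tau> l] assms(1) False g(1) by blast
  \<comment> \<open>The entry \<open>y = z\<close> of the minimum already equals
    \<open>h z\<close>.\<close>
  have le: "sem \<tau> l (g x) z \<le> h z" if "x \<in> S" "z \<in> S" for x z
    using that assms(1) False f(3)[of x z] by (auto simp: g(2) Min_le_iff intro!: bexI[of _ z])
  \<comment> \<open>Every \<open>f z y\<close> takes the value \<open>h z\<close> at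
    \<open>z\<close>, so this is the minimum of a constant family.\<close>
  have eq: "sem \<tau> l (g z) z = h z" if "z \<in> S" for z
    using that False by (simp add: g(2) f(2) image_constant_conv)
  \<comment> \<open>By \<open>le\<close> no entry of the maximum exceeds \<open>h z\<close>; by
    \<open>eq\<close> the entry \<open>x = z\<close> attains it.\<close>
  have "sem \<tau> l \<psi> z = h z" if "z \<in> S" for z
    unfolding \<psi>(2)
    using that assms(1) le eq by (intro Max_eqI) (auto intro: rev_image_eqI)
  with \<psi>(1) show ?thesis by blast
qed

lemma separable_expect:
  assumes dist: "\<And>s. \<tau> s \<in> rat_distributions"
    and h: "\<And>z. z \<in> supp (\<tau> x) \<union> supp (\<tau> y) \<Longrightarrow> h z \<in> {0..1}"
    and sep: "\<And>u v. u \<in> supp (\<tau> x) \<union> supp (\<tau> y) \<Longrightarrow> v \<in> supp (\<tau> x) \<union> supp (\<tau> y) \<Longrightarrow>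
      h v < h u \<Longrightarrow> separable \<tau> l u (h u - h v) v"
    and \<epsilon>: "\<epsilon> \<in> {0..1}" "\<epsilon> \<le> (\<tau> x \<Turnstile> h) - (\<tau> y \<Turnstile> h)"
  shows "separable \<tau> l x \<epsilon> y"
proof -
  let ?S = "supp (\<tau> x) \<union> supp (\<tau> y)"
  have "\<exists>\<phi>\<in>logic. sem \<tau> l \<phi> u = h u \<and> sem \<tau> l \<phi> v = h v" if "u \<in> ?S" "v \<in> ?S" for u v
  proof (rule linorder_cases[of "h u" "h v"])
    assume "h u < h v"
    then show ?thesis
      \<comment> \<open>Interpolation at two points is symmetric in them, so the formula for the
        swapped pair serves.\<close>
      using separable_shift[OF sep h h, of v u] that by blast
  next
    assume "h u = h v"
    then show ?thesis
      using separable_shift[of \<tau> l u "h u" "h v" v] separable_zero[of \<tau> l u v] h that by simp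
  next
    assume "h v < h u"
    then show ?thesis
      using separable_shift[OF sep h h, of u v] that by blast
  qed
  moreover have "finite ?S"
    using dist by (simp add: rat_distributions_def)
  ultimately obtain \<psi> where \<psi>: "\<psi> \<in> logic" "\<forall>z\<in>?S. sem \<tau> l \<psi> z = h z"
    using logic_interpolation[of ?S \<tau> l h] by blast
  then have x: "sem \<tau> l (Next \<psi>) x = \<tau> x \<Turnstile> h" and y: "sem \<tau> l (Next \<psi>) y = \<tau> y \<Turnstile> h"
    by (simp_all add: expect_def)
  have next_logic: "Next \<psi> \<in> logic"
    using \<psi>(1) by (rule logic.intros)
  \<comment> \<open>As \<open>h\<close> is bounded only on the two supports, the bounds are read off
    from the semantics of \<open>Next \<psi>\<close>.\<close>
  have unit: "\<tau> x \<Turnstile> h \<in> {0..1}" "\<tau> y \<Turnstile> h \<in> {0..1}"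
    unfolding x[symmetric] y[symmetric] by (rule sem_unit_interval[OF dist next_logic])+
  \<comment> \<open>The difference is at least \<epsilon> and hence nonnegative, so truncation does
    not alter it at \<open>x\<close>, while the value at \<open>y\<close> becomes 0.\<close>
  have "separable \<tau> l x ((\<tau> x \<Turnstile> h) - (\<tau> y \<Turnstile> h)) y"
    unfolding separable_def
  proof (intro conjI bexI)
    show "Minus (Next \<psi>) (\<tau> y \<Turnstile> h) \<in> logic"
      using next_logic unit(2) by (rule logic.intros)
  qed (use unit \<epsilon> x y in auto)
  then show ?thesis
    using \<epsilon> by (rule separable_weaken)
qed

lemma apart_imp_separable:
  assumes "\<And>s. \<tau> s \<in> rat_distributions" and "apart \<tau> l x \<epsilon> y"
  shows "separable \<tau> l x \<epsilon> y"
  using assms(2)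
proof induction
  case (zero x y)
  show ?case by (rule separable_zero)
next
  case (symm y \<epsilon> x)
  from symm.IH show ?case by (rule separable_sym)
next
  case (weak x \<epsilon>' y \<epsilon>)
  from weak.IH weak.hyps(2,3) show ?case by (rule separable_weaken)
next
  case (lab x y)
  then show ?case by (rule separable_label)
next
  case (exp x y h \<epsilon>)
  show ?case
    by (rule separable_expect[OF assms(1), where h = h]) (use exp in blast)+
qed

theorem theorem21:
  fixes \<tau> :: "'x \<Rightarrow> 'x \<Rightarrow> rat" and l :: "'x \<Rightarrow> 'l" and \<epsilon> :: rat and x y :: 'x
  assumes "\<And>s. \<tau> s \<in> rat_distributions"
    and "\<epsilon> \<in> {0..1}"
    and "apart \<tau> l x \<epsilon> y"
  shows "\<exists>\<phi> \<in> logic. sem \<tau> l \<phi> x = \<epsilon> \<and> sem \<tau> l \<phi> y = 0"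
  using apart_imp_separable[OF assms(1,3)] by (simp add: separable_def)

end
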